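(* Let $n\ge1$ be an integer and let $f=[f_0:\dots:f_n]:\mathbb{R}\to\mathbb{TP}^n$ be a tropical holomorphic map (with reduced representation $(f_0,\dots,f_n)$) which is tropically linearly nondegenerate. If $H$ is a tropical hyperplane in $\mathbb{TP}^n$ defined by the tropical polynomial $P(x)=(a_0\otimes x_0)\oplus\dots\oplus(a_n\otimes x_n)$ with all $a_0,\dots,a_n\in\mathbb{R}$, then $$T_f(r)=N\bigl(r,1_{\mathbb{T}}\oslash(P\circ f)\bigr)+O(1),$$ where $O(1)$ denotes a quantity bounded independently of $r>0$.
   Context: Tropical semiring: $\mathbb{T}=\mathbb{R}\cup\{-\infty\}$, $x\oplus y=\max(x,y)$, $x\otimes y=x+y$, $x\oslash y=x-y$, $0_{\mathbb{T}}=-\infty$, $1_{\mathbb{T}}=0$. Tropical projective space $\mathbb{TP}^n$ is $\mathbb{T}^{n+1}\setminus\{(0_{\mathbb{T}},\dots,0_{\mathbb{T}})\}$ modulo $(a_0,\dots,a_n)\sim(\lambda+a_0,\dots,\lambda+a_n)$, $\lambda\in\mathbb{R}$. Hyperplanes: a tropical linear polynomial is $P(x)=\max_{0\le i\le n}(a_i+x_i)$ with coefficient vector $a=(a_0,\dots,a_n)\in\mathbb{T}^{n+1}$ not all $0_{\mathbb{T}}$. The tropical hyperplane it defines is $H=\{x\in\mathbb{TP}^n:\ \max_i(a_i+x_i)\text{ is attained for at least two indices } i\}$ (in particular $x\in H$ if all terms are $-\infty$). Functions: a tropical meromorphic function is a continuous piecewise linear $g:\mathbb{R}\to\mathbb{R}$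 (real slopes, finitely many non-differentiability points in each bounded interval). Put $\omega_g(x)=\lim_{\varepsilon\to0^+}(g'(x+\varepsilon)-g'(x-\varepsilon))$; $x$ is a root of multiplicity $\omega_g(x)$ if $\omega_g(x)>0$, and a pole of multiplicity $-\omega_g(x)$ if $\omega_g(x)<0$. A tropical entire function is a tropical meromorphic function without poles. The counting function is $N(r,g)=\frac12\int_0^r n(t,g)\,dt$ with $n(t,g)=\sum_{|s|\le t,\ \omega_g(s)<0}|\omega_g(s)|$ (poles); thus $N(r,1_{\mathbb{T}}\oslash g)=N(r,-g)$ counts the roots of $g$. Curves: a tropical holomorphic map (curve) $f=[f_0:\dots:f_n]:\mathbb{R}\to\mathbb{TP}^n$ is given by tropical entire functions $f_0,\dots,f_n$ having no common root (reduced representation). Put $\|f(x)\|=\max_i f_i(x)$, $T_f(r)=\frac12(\|f(r)\|+\|f(-r)\|)-\|f(0)\|$, and $P\circ f=\max_i(a_i+f_i)$. The map $f$ is tropically linearly nondegenerate if $f(\mathbb{R})$ is not contained in any tropical hyperplane of $\mathbb{TP}^n$. *)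

theory Defs
  imports "HOL-Analysis.Analysis" "HOL-Library.FuncSet"
begin

section \<open>Tropical projective space and tropical hyperplanes\<close>

text \<open>
  The tropical semiring is the set of extended reals other than \<open>\<infinity>\<close>; tropical addition is
  \<^const>\<open>max\<close> and tropical multiplication is \<open>+\<close>.  Vectors with \<open>n + 1\<close> entries are functions
  on the index set \<open>{..n}\<close>.
\<close>

definition trop :: "ereal set" where
  "trop = {x. x \<noteq> \<infinity>}"

definition trop_vecs :: "nat \<Rightarrow> (nat \<Rightarrow> ereal) set" where
  "trop_vecs n = ({..n} \<rightarrow>\<^sub>E trop) - {\<lambda>i\<in>{..n}. -\<infinity>}"

definition trop_proj_rel :: "nat \<Rightarrow> ((nat \<Rightarrow> ereal) \<times> (nat \<Rightarrow> ereal)) set" where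
  "trop_proj_rel n =
     {(x, y). x \<in> trop_vecs n \<and> y \<in> trop_vecs n \<and> (\<exists>l::real. \<forall>i\<le>n. y i = ereal l + x i)}"

definition trop_proj_space :: "nat \<Rightarrow> (nat \<Rightarrow> ereal) set set" where
  "trop_proj_space n = trop_vecs n // trop_proj_rel n"

definition trop_point :: "nat \<Rightarrow> (nat \<Rightarrow> ereal) \<Rightarrow> (nat \<Rightarrow> ereal) set" where
  "trop_point n x = trop_proj_rel n `` {restrict x {..n}}"

text \<open>
  Polymorphic, so that it can be used both with coefficients in the tropical semiring
  and, for real coefficients and arguments, as a real-valued function.
\<close>

definition trop_linear ::
    "nat \<Rightarrow> (nat \<Rightarrow> 'a) \<Rightarrow> (nat \<Rightarrow> 'a) \<Rightarrow> 'a::{linorder,plus}" where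
  "trop_linear n a x = (MAX i\<in>{..n}. a i + x i)"

definition trop_hyperplane :: "nat \<Rightarrow> (nat \<Rightarrow> ereal) \<Rightarrow> (nat \<Rightarrow> ereal) set set" where
  "trop_hyperplane n a =
     {trop_point n x | x. x \<in> trop_vecs n \<and>
        (\<exists>i\<le>n. \<exists>j\<le>n. i \<noteq> j \<and> a i + x i = trop_linear n a x \<and> a j + x j = trop_linear n a x)}"

definition trop_hyperplanes :: "nat \<Rightarrow> (nat \<Rightarrow> ereal) set set set" where
  "trop_hyperplanes n = trop_hyperplane n ` trop_vecs n"


section \<open>Tropical meromorphic and entire functions\<close>

text \<open>
  Piecewise linearity is expressed by: the non-differentiability points are locally finite, and the
  function is affine on every open interval that contains none of them.
\<close>

definition trop_meromorphic :: "(real \<Rightarrow> real) \<Rightarrow> bool" where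
  "trop_meromorphic g \<longleftrightarrow>
     continuous_on UNIV g \<and>
     (\<forall>a b. finite {x \<in> {a..b}. \<not> g differentiable (at x)}) \<and>
     (\<forall>a b. (\<forall>x\<in>{a<..<b}. g differentiable (at x)) \<longrightarrow>
              (\<exists>m c. \<forall>x\<in>{a<..<b}. g x = m * x + c))"

definition trop_omega :: "(real \<Rightarrow> real) \<Rightarrow> real \<Rightarrow> real" where
  "trop_omega g x = Lim (at_right 0) (\<lambda>\<epsilon>. deriv g (x + \<epsilon>) - deriv g (x - \<epsilon>))"

definition trop_root :: "(real \<Rightarrow> real) \<Rightarrow> real \<Rightarrow> bool" where
  "trop_root g x \<longleftrightarrow> trop_omega g x > 0"

definition trop_pole :: "(real \<Rightarrow> real) \<Rightarrow> real \<Rightarrow> bool" where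
  "trop_pole g x \<longleftrightarrow> trop_omega g x < 0"

definition trop_entire :: "(real \<Rightarrow> real) \<Rightarrow> bool" where
  "trop_entire g \<longleftrightarrow> trop_meromorphic g \<and> (\<forall>x. \<not> trop_pole g x)"

definition trop_pole_count :: "real \<Rightarrow> (real \<Rightarrow> real) \<Rightarrow> real" where
  "trop_pole_count t g = (\<Sum>s | \<bar>s\<bar> \<le> t \<and> trop_pole g s. \<bar>trop_omega g s\<bar>)"

definition trop_counting :: "real \<Rightarrow> (real \<Rightarrow> real) \<Rightarrow> real" where
  "trop_counting r g = 1 / 2 * integral {0..r} (\<lambda>t. trop_pole_count t g)"

text \<open>The tropical reciprocal of a function; the tropical unit is the real number \<open>0\<close>.\<close>

definition trop_recip :: "(real \<Rightarrow> real) \<Rightarrow> real \<Rightarrow> real" where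
  "trop_recip g = (\<lambda>x. 0 - g x)"


section \<open>Tropical holomorphic curves\<close>

text \<open>The family \<open>f\<close> is a reduced representation; only the members \<open>f 0, \<dots>, f n\<close> matter.\<close>

definition trop_reduced_rep :: "nat \<Rightarrow> (nat \<Rightarrow> real \<Rightarrow> real) \<Rightarrow> bool" where
  "trop_reduced_rep n f \<longleftrightarrow>
     (\<forall>i\<le>n. trop_entire (f i)) \<and> \<not> (\<exists>x. \<forall>i\<le>n. trop_root (f i) x)"

definition trop_curve :: "nat \<Rightarrow> (nat \<Rightarrow> real \<Rightarrow> real) \<Rightarrow> real \<Rightarrow> (nat \<Rightarrow> ereal) set" where
  "trop_curve n f x = trop_point n (\<lambda>i. ereal (f i x))"

definition trop_lin_nondegenerate :: "nat \<Rightarrow> (real \<Rightarrow> (nat \<Rightarrow> ereal) set) \<Rightarrow> bool" where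
  "trop_lin_nondegenerate n F \<longleftrightarrow> (\<forall>H\<in>trop_hyperplanes n. \<not> range F \<subseteq> H)"

definition trop_norm :: "nat \<Rightarrow> (nat \<Rightarrow> real \<Rightarrow> real) \<Rightarrow> real \<Rightarrow> real" where
  "trop_norm n f x = (MAX i\<in>{..n}. f i x)"

definition trop_characteristic :: "nat \<Rightarrow> (nat \<Rightarrow> real \<Rightarrow> real) \<Rightarrow> real \<Rightarrow> real" where
  "trop_characteristic n f r =
     1 / 2 * (trop_norm n f r + trop_norm n f (- r)) - trop_norm n f 0"

definition trop_comp :: "nat \<Rightarrow> (nat \<Rightarrow> real) \<Rightarrow> (nat \<Rightarrow> real \<Rightarrow> real) \<Rightarrow> real \<Rightarrow> real" where
  "trop_comp n a f = (\<lambda>x. trop_linear n a (\<lambda>i. f i x))"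

end

theory Submission
  imports Defs
begin

text \<open>
  The composition \<open>P \<circ> f = (MAX i. a i + f i)\<close> differs from \<open>\<parallel>f\<parallel> = (MAX i. f i)\<close> by at most
  \<open>MAX i. \<bar>a i\<bar>\<close>, because all coefficients are real.  It is therefore enough to compute the
  counting function of the roots of \<open>g = P \<circ> f\<close> exactly, by the tropical Jensen formula
  \<open>N(r, -g) = (g r + g (-r)) / 2 - g 0\<close> for a piecewise linear function \<open>g\<close> with increasing
  slopes; the characteristic function is the same expression in \<open>\<parallel>f\<parallel>\<close>.

  Jensen's formula comes from the representation of \<open>g\<close> on \<open>{-r..r}\<close> as an affine function plus
  the ramps \<open>\<omega>(s) * max 0 (x - s)\<close>, one for each of the finitely many roots \<open>s\<close> in the
  interval.  The second difference \<open>g r + g (-r) - 2 * g 0\<close> kills the affine part and turns the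
  ramp at \<open>s\<close> into \<open>r - \<bar>s\<bar>\<close>, which is also the length of the set of \<open>t \<le> r\<close> for which \<open>s\<close> is
  counted.

  Everything is done with one-sided slopes at a point.  They add, they are easily followed through
  maxima (so that a maximum of tropical entire functions again has increasing slopes), and their
  difference is the multiplicity \<open>\<omega>\<close>.
\<close>

section \<open>One-sided slopes\<close>

text \<open>
  Existence of slopes at every point is local piecewise linearity.  Unlike the description by
  non-differentiability points, this form passes to sums and maxima pointwise.
\<close>

definition has_slopes :: "(real \<Rightarrow> real) \<Rightarrow> real \<Rightarrow> real \<Rightarrow> real \<Rightarrow> bool" where
  "has_slopes g x l m \<longleftrightarrow>
     (\<forall>\<^sub>F e in at_right 0. g (x + e) = g x + m * e \<and> g (x - e) = g x - l * e)"

lemma has_slopes_iff: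
  "has_slopes g x l m \<longleftrightarrow>
     (\<exists>d>0. \<forall>e. 0 \<le> e \<and> e < d \<longrightarrow> g (x + e) = g x + m * e \<and> g (x - e) = g x - l * e)"
    (is "_ \<longleftrightarrow> (\<exists>d>0. ?P d)")
proof
  assume "has_slopes g x l m"
  then obtain d where "d > 0"
    and d: "\<And>e. 0 < e \<Longrightarrow> e < d \<Longrightarrow> g (x + e) = g x + m * e \<and> g (x - e) = g x - l * e"
    unfolding has_slopes_def eventually_at_right_field by auto
  have "?P d"
  proof (intro allI impI)
    fix e assume "0 \<le> e \<and> e < d"
    then show "g (x + e) = g x + m * e \<and> g (x - e) = g x - l * e"
      using d by (cases "e = 0") auto
  qed
  with \<open>d > 0\<close> show "\<exists>d>0. ?P d" by blast
next
  assume "\<exists>d>0. ?P d"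
  then show "has_slopes g x l m"
    unfolding has_slopes_def eventually_at_right_field by (meson less_imp_le)
qed

lemma has_slopes_affine: "has_slopes (\<lambda>x. k * x + c) x k k"
  by (simp add: has_slopes_def algebra_simps)

lemma has_slopes_add:
  assumes "has_slopes g x l m" "has_slopes h x l' m'"
  shows "has_slopes (\<lambda>x. g x + h x) x (l + l') (m + m')"
  using assms unfolding has_slopes_def by eventually_elim (simp add: algebra_simps)

lemma has_slopes_cmult:
  assumes "has_slopes g x l m"
  shows "has_slopes (\<lambda>x. c * g x) x (c * l) (c * m)"
  using assms unfolding has_slopes_def
  by eventually_elim (simp add: right_diff_distrib distrib_left)

lemma has_slopes_diff:
  assumes "has_slopes g x l m" "has_slopes h x l' m'"
  shows "has_slopes (\<lambda>x. g x - h x) x (l - l') (m - m')"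
  using has_slopes_add[OF assms(1) has_slopes_cmult[OF assms(2), of "-1"]] by simp

lemma has_slopes_sum:
  assumes "finite S" "\<And>s. s \<in> S \<Longrightarrow> has_slopes (g s) x (l s) (m s)"
  shows "has_slopes (\<lambda>x. \<Sum>s\<in>S. g s x) x (\<Sum>s\<in>S. l s) (\<Sum>s\<in>S. m s)"
  using assms
proof (induction S rule: finite_induct)
  case empty
  show ?case by (simp add: has_slopes_def)
next
  case (insert s S)
  then show ?case using has_slopes_add[of "g s" x "l s" "m s"] by simp
qed

lemma has_slopes_tendsto:
  assumes "has_slopes g x l m"
  shows "((\<lambda>e. g (x + e)) \<longlongrightarrow> g x) (at_right 0)" "((\<lambda>e. g (x - e)) \<longlongrightarrow> g x) (at_right 0)"
proof -
  have "((\<lambda>e. g x + m * e) \<longlongrightarrow> g x + m * 0) (at_right 0)"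
    "((\<lambda>e. g x - l * e) \<longlongrightarrow> g x - l * 0) (at_right 0)"
    by (intro tendsto_intros)+
  moreover have "\<forall>\<^sub>F e in at_right 0. g x + m * e = g (x + e)"
    "\<forall>\<^sub>F e in at_right 0. g x - l * e = g (x - e)"
    using assms unfolding has_slopes_def by (eventually_elim, simp)+
  ultimately show "((\<lambda>e. g (x + e)) \<longlongrightarrow> g x) (at_right 0)"
    "((\<lambda>e. g (x - e)) \<longlongrightarrow> g x) (at_right 0)"
    by (auto intro: Lim_transform_eventually)
qed

text \<open>Where one function is strictly larger, continuity makes it the maximum nearby.\<close>

lemma has_slopes_max_less:
  assumes g: "has_slopes g x l m" and h: "has_slopes h x l' m'" and less: "g x < h x"
  shows "has_slopes (\<lambda>x. max (g x) (h x)) x l' m'"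
proof -
  have pos: "((\<lambda>e. h (x + e) - g (x + e)) \<longlongrightarrow> h x - g x) (at_right 0)"
    "((\<lambda>e. h (x - e) - g (x - e)) \<longlongrightarrow> h x - g x) (at_right 0)"
    by (intro tendsto_diff has_slopes_tendsto[OF g] has_slopes_tendsto[OF h])+
  have "\<forall>\<^sub>F e in at_right 0. h (x + e) - g (x + e) > 0"
    "\<forall>\<^sub>F e in at_right 0. h (x - e) - g (x - e) > 0"
    using pos[THEN order_tendstoD(1), of 0] less by auto
  with h show ?thesis
    unfolding has_slopes_def by eventually_elim (use less in \<open>auto simp: max_def\<close>)
qed

text \<open>
  Where the two functions agree, the larger slope wins on the right and the smaller one on the
  left.
\<close>

lemma has_slopes_max_eq:
  assumes g: "has_slopes g x l m" and h: "has_slopes h x l' m'" and eq: "g x = h x"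
  shows "has_slopes (\<lambda>x. max (g x) (h x)) x (min l l') (max m m')"
proof -
  have "\<forall>\<^sub>F e :: real in at_right 0. e > 0"
    by (simp add: eventually_at_right_less)
  with g h show ?thesis
    unfolding has_slopes_def
    by eventually_elim (auto simp: eq max_def min_def)
qed

text \<open>The slopes at \<open>x\<close> persist on either side of \<open>x\<close>, where the function is affine.\<close>

lemma has_slopes_nearby:
  assumes "has_slopes g x l m"
  shows "\<forall>\<^sub>F e in at_right 0. has_slopes g (x + e) m m \<and> has_slopes g (x - e) l l"
proof -
  obtain d where "d > 0"
    and d: "\<And>e. 0 \<le> e \<Longrightarrow> e < d \<Longrightarrow> g (x + e) = g x + m * e"
           "\<And>e. 0 \<le> e \<Longrightarrow> e < d \<Longrightarrow> g (x - e) = g x - l * e"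
    using assms unfolding has_slopes_iff by blast
  have "has_slopes g (x + e) m m \<and> has_slopes g (x - e) l l" if e: "0 < e" "e < d" for e
  proof -
    have "0 < min e (d - e)" using e by simp
    moreover have "g (x + e + u) = g (x + e) + m * u" "g (x + e - u) = g (x + e) - m * u"
      "g (x - e + u) = g (x - e) + l * u" "g (x - e - u) = g (x - e) - l * u"
      if u: "0 \<le> u \<and> u < min e (d - e)" for u
      using d[of e] d[of "e + u"] d[of "e - u"] u e by (simp_all add: algebra_simps)
    ultimately show ?thesis unfolding has_slopes_iff by blast
  qed
  then show ?thesis
    unfolding eventually_at_right_field using \<open>d > 0\<close> by auto
qed

lemma eventually_at_sides:
  fixes x :: real
  assumes "\<forall>\<^sub>F e in at_right 0. P (x + e) \<and> P (x - e)"
  shows "\<forall>\<^sub>F y in at x. P y"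
proof -
  obtain d where "d > 0" and d: "\<And>e. 0 < e \<Longrightarrow> e < d \<Longrightarrow> P (x + e) \<and> P (x - e)"
    using assms unfolding eventually_at_right_field by auto
  have "P y" if "y \<noteq> x" "dist y x < d" for y
    using that d[of "y - x"] d[of "x - y"] by (cases "y < x") (auto simp: dist_real_def)
  then show ?thesis
    unfolding eventually_at using \<open>d > 0\<close> by blast
qed

lemma has_slopes_DERIV:
  assumes "has_slopes g x k k"
  shows "(g has_real_derivative k) (at x)"
proof -
  have "\<forall>\<^sub>F y in at x. g y = g x + k * (y - x)"
    by (rule eventually_at_sides)
       (use assms in \<open>auto simp: has_slopes_def algebra_simps elim: eventually_mono\<close>)
  then have "\<forall>\<^sub>F y in nhds x. g y = g x + k * (y - x)"
    unfolding eventually_at_filter by (rule eventually_mono) auto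
  moreover have "((\<lambda>y. g x + k * (y - x)) has_real_derivative k) (at x)"
    by (auto intro!: derivative_eq_intros)
  ultimately show ?thesis
    by (subst DERIV_cong_ev) auto
qed

lemma trop_omega_eq:
  assumes "has_slopes g x l m"
  shows "trop_omega g x = m - l"
proof -
  have "\<forall>\<^sub>F e in at_right 0. deriv g (x + e) - deriv g (x - e) = m - l"
    using has_slopes_nearby[OF assms]
    by eventually_elim (auto dest!: has_slopes_DERIV DERIV_imp_deriv)
  then have "((\<lambda>e. deriv g (x + e) - deriv g (x - e)) \<longlongrightarrow> m - l) (at_right 0)"
    by (rule tendsto_eventually)
  then show ?thesis
    unfolding trop_omega_def by (intro tendsto_Lim) auto
qed


section \<open>Functions with increasing slopes\<close>

definition increasing_slopes :: "(real \<Rightarrow> real) \<Rightarrow> bool" where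
  "increasing_slopes g \<longleftrightarrow> (\<forall>x. \<exists>l m. l \<le> m \<and> has_slopes g x l m)"

lemma affine_extend_to_endpoint:
  fixes g :: "real \<Rightarrow> real"
  assumes cont: "continuous_on UNIV g" and F: "F \<le> at x" "F \<noteq> bot"
    and aff: "\<forall>\<^sub>F y in F. g y = m * y + c"
  shows "g x = m * x + c"
proof -
  have "(g \<longlongrightarrow> g x) F"
    using cont F(1) by (meson UNIV_I continuous_on_def tendsto_mono)
  moreover have "((\<lambda>y. m * y + c) \<longlongrightarrow> m * x + c) F"
    by (intro tendsto_intros tendsto_mono[OF F(1) tendsto_ident_at])
  then have "(g \<longlongrightarrow> m * x + c) F"
    by (rule Lim_transform_eventually) (use aff in \<open>simp add: eq_commute\<close>)
  ultimately show ?thesis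
    using F(2) tendsto_unique by blast
qed

text \<open>
  Non-differentiability points do not accumulate at \<open>x\<close>, so the function is affine on an open
  interval on each side of \<open>x\<close>, and by continuity up to \<open>x\<close>.
\<close>

lemma trop_meromorphic_has_slopes:
  assumes "trop_meromorphic g"
  shows "\<exists>l m. has_slopes g x l m"
proof -
  let ?B = "{y \<in> {x - 1..x + 1}. \<not> g differentiable (at y)}"
  have cont: "continuous_on UNIV g" and fin: "finite ?B"
    and aff: "\<And>a b. (\<forall>y\<in>{a<..<b}. g differentiable (at y)) \<Longrightarrow>
                \<exists>m c. \<forall>y\<in>{a<..<b}. g y = m * y + c"
    using assms unfolding trop_meromorphic_def by blast+
  obtain d where "d > 0" and d: "\<And>y. y \<in> ?B \<Longrightarrow> y \<noteq> x \<Longrightarrow> d \<le> dist x y"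
    using finite_set_avoid[OF fin, of x] by blast
  define e where "e = min d 1"
  have e: "0 < e" "e \<le> d" "e \<le> 1" using \<open>d > 0\<close> by (auto simp: e_def)
  have diff: "g differentiable (at y)" if "y \<noteq> x" "\<bar>y - x\<bar> < e" for y
  proof (rule ccontr)
    assume "\<not> g differentiable (at y)"
    with that e have "y \<in> ?B" by auto
    from d[OF this \<open>y \<noteq> x\<close>] that e show False by (simp add: dist_real_def)
  qed
  obtain m c where m: "\<And>y. x < y \<Longrightarrow> y < x + e \<Longrightarrow> g y = m * y + c"
    using aff[of x "x + e"] diff by fastforce
  obtain l c' where l: "\<And>y. x - e < y \<Longrightarrow> y < x \<Longrightarrow> g y = l * y + c'"
    using aff[of "x - e" x] diff by fastforce
  have "g x = m * x + c"
  proof (rule affine_extend_to_endpoint[OF cont])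
    show "\<forall>\<^sub>F y in at_right x. g y = m * y + c"
      unfolding eventually_at_right_field using m e by (intro exI[of _ "x + e"]) auto
  qed (auto simp: at_le)
  moreover have "g x = l * x + c'"
  proof (rule affine_extend_to_endpoint[OF cont])
    show "\<forall>\<^sub>F y in at_left x. g y = l * y + c'"
      unfolding eventually_at_left_field using l e by (intro exI[of _ "x - e"]) auto
  qed (auto simp: at_le)
  ultimately have "g (x + u) = g x + m * u \<and> g (x - u) = g x - l * u" if "0 \<le> u \<and> u < e" for u
    using that m[of "x + u"] l[of "x - u"] by (cases "u = 0") (auto simp: algebra_simps)
  then show ?thesis
    unfolding has_slopes_iff using e by blast
qed

lemma trop_entire_increasing_slopes:
  assumes "trop_entire g"
  shows "increasing_slopes g"
  unfolding increasing_slopes_def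
proof
  fix x
  obtain l m where "has_slopes g x l m"
    using assms trop_meromorphic_has_slopes unfolding trop_entire_def by blast
  moreover have "trop_omega g x \<ge> 0"
    using assms unfolding trop_entire_def trop_pole_def by (auto simp: not_less)
  ultimately show "\<exists>l m. l \<le> m \<and> has_slopes g x l m"
    using trop_omega_eq by fastforce
qed

lemma increasing_slopes_add_const:
  assumes "increasing_slopes g"
  shows "increasing_slopes (\<lambda>x. c + g x)"
  using assms by (simp add: increasing_slopes_def has_slopes_def)

lemma increasing_slopes_max:
  assumes "increasing_slopes g" "increasing_slopes h"
  shows "increasing_slopes (\<lambda>x. max (g x) (h x))"
  unfolding increasing_slopes_def
proof
  fix x
  obtain l m l' m' where g: "l \<le> m" "has_slopes g x l m" and h: "l' \<le> m'" "has_slopes h x l' m'"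
    using assms unfolding increasing_slopes_def by meson
  consider "g x < h x" | "g x = h x" | "h x < g x" by linarith
  then show "\<exists>l m. l \<le> m \<and> has_slopes (\<lambda>x. max (g x) (h x)) x l m"
  proof cases
    case 1
    then show ?thesis using has_slopes_max_less[OF g(2) h(2)] h(1) by blast
  next
    case 2
    moreover have "min l l' \<le> max m m'" using g(1) by linarith
    ultimately show ?thesis using has_slopes_max_eq[OF g(2) h(2)] by blast
  next
    case 3
    then show ?thesis using has_slopes_max_less[OF h(2) g(2)] g(1) by (auto simp: max.commute)
  qed
qed

lemma increasing_slopes_Max:
  fixes g :: "nat \<Rightarrow> real \<Rightarrow> real"
  assumes "\<And>i. i \<le> n \<Longrightarrow> increasing_slopes (g i)"
  shows "increasing_slopes (\<lambda>x. MAX i\<in>{..n}. g i x)"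
  using assms
proof (induction n)
  case 0
  then show ?case by simp
next
  case (Suc n)
  have "(MAX i\<in>{..Suc n}. g i x) = max (g (Suc n) x) (MAX i\<in>{..n}. g i x)" for x
    by (simp add: atMost_Suc)
  moreover have "increasing_slopes (\<lambda>x. max (g (Suc n) x) (MAX i\<in>{..n}. g i x))"
    using Suc by (intro increasing_slopes_max) auto
  ultimately show ?case by simp
qed


section \<open>The tropical Jensen formula\<close>

text \<open>
  Next to any point the function is affine on both sides, so breaks cannot accumulate in a compact
  interval.
\<close>

lemma finite_breaks:
  assumes "\<And>x. has_slopes g x (l x) (m x)"
  shows "finite {s. \<bar>s\<bar> \<le> r \<and> l s \<noteq> m s}"
proof (rule ccontr)
  assume inf: "infinite {s. \<bar>s\<bar> \<le> r \<and> l s \<noteq> m s}" (is "infinite ?B")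
  have "?B \<subseteq> {-r..r}" by auto
  then obtain x where "x islimpt ?B"
    using inf compact_Icc[of "-r" r] unfolding compact_eq_Bolzano_Weierstrass by blast
  then have "\<exists>\<^sub>F y in at x. y \<in> ?B"
    by (simp add: islimpt_iff_eventually frequently_def)
  moreover have "l y = m y" if "has_slopes g y k k" for y k
    using trop_omega_eq[OF that] trop_omega_eq[OF assms[of y]] by simp
  then have "\<forall>\<^sub>F y in at x. l y = m y"
    using has_slopes_nearby[OF assms[of x]]
    by (intro eventually_at_sides) (auto elim!: eventually_mono)
  then have "\<forall>\<^sub>F y in at x. y \<notin> ?B"
    by eventually_elim simp
  ultimately show False
    by (simp add: frequently_def)
qed

text \<open>
  Absence of breaks makes the derivative locally constant, and hence constant on an interval.
\<close>

lemma affine_if_no_breaks: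
  assumes slopes: "\<And>x. x \<in> {a..b} \<Longrightarrow> \<exists>k. has_slopes h x k k"
  shows "\<exists>k c. \<forall>x\<in>{a..b}. h x = k * x + c"
proof -
  have deriv: "(h has_real_derivative deriv h x) (at x)" if "x \<in> {a..b}" for x
    using slopes[OF that] has_slopes_DERIV DERIV_imp_deriv by metis
  have "(deriv h has_real_derivative 0) (at x within {a..b})" if x: "x \<in> {a..b}" for x
  proof -
    obtain k where k: "has_slopes h x k k" using slopes[OF x] by blast
    have "\<forall>\<^sub>F y in at x. deriv h y = k"
      using has_slopes_nearby[OF k]
      by (intro eventually_at_sides)
         (auto elim!: eventually_mono dest!: has_slopes_DERIV DERIV_imp_deriv)
    moreover have "deriv h x = k"
      using k has_slopes_DERIV DERIV_imp_deriv by blast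
    ultimately have "\<forall>\<^sub>F y in nhds x. deriv h y = k"
      by (auto simp: eventually_at_filter elim!: eventually_mono)
    then have "(deriv h has_real_derivative 0) (at x)"
      by (subst DERIV_cong_ev[where g = "\<lambda>_. k"]) auto
    then show ?thesis by (rule has_field_derivative_at_within)
  qed
  then obtain k where k: "\<And>x. x \<in> {a..b} \<Longrightarrow> deriv h x = k"
    using has_field_derivative_zero_constant[of "{a..b}" "deriv h"] by auto
  have "((\<lambda>x. h x - k * x) has_real_derivative 0) (at x within {a..b})" if "x \<in> {a..b}" for x
    using deriv[OF that] k[OF that]
    by (auto intro!: derivative_eq_intros intro: has_field_derivative_at_within)
  then obtain c where "\<And>x. x \<in> {a..b} \<Longrightarrow> h x - k * x = c"
    using has_field_derivative_zero_constant[of "{a..b}" "\<lambda>x. h x - k * x"] by auto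
  then show ?thesis
    by (intro exI[of _ k] exI[of _ c]) (force simp: algebra_simps)
qed

lemma has_slopes_ramp:
  "has_slopes (\<lambda>x. max 0 (x - s)) x (if x \<le> s then 0 else 1) (if x < s then 0 else 1)"
proof -
  have zero: "has_slopes (\<lambda>x. 0) x 0 0" and line: "has_slopes (\<lambda>x. x - s) x 1 1"
    using has_slopes_affine[of 0 0] has_slopes_affine[of 1 "-s"] by simp_all
  consider "x < s" | "x = s" | "x > s" by linarith
  then show ?thesis
  proof cases
    case 1
    then show ?thesis using has_slopes_max_less[OF line zero] by (simp add: max.commute)
  next
    case 2
    then show ?thesis using has_slopes_max_eq[OF zero line] by simp
  next
    case 3
    then show ?thesis using has_slopes_max_less[OF zero line] by simp
  qed
qed

text \<open>
  Subtracting, at every break, a ramp whose slope is the jump there leaves a function without breaks.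
\<close>

lemma ramp_representation:
  assumes slopes: "\<And>x. has_slopes g x (l x) (m x)"
    and fin: "finite S" and S: "\<And>x. x \<in> {a..b} \<Longrightarrow> l x \<noteq> m x \<Longrightarrow> x \<in> S"
  shows "\<exists>k c. \<forall>x\<in>{a..b}. g x = k * x + c + (\<Sum>s\<in>S. (m s - l s) * max 0 (x - s))"
proof -
  define p where "p = (\<lambda>x. \<Sum>s\<in>S. (m s - l s) * max 0 (x - s))"
  have "\<exists>k. has_slopes (\<lambda>x. g x - p x) x k k" if x: "x \<in> {a..b}" for x
  proof -
    let ?L = "\<Sum>s\<in>S. (m s - l s) * (if x \<le> s then 0 else 1)"
    let ?M = "\<Sum>s\<in>S. (m s - l s) * (if x < s then 0 else 1)"
    have "has_slopes p x ?L ?M"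
      unfolding p_def by (intro has_slopes_sum has_slopes_cmult has_slopes_ramp fin)
    then have "has_slopes (\<lambda>x. g x - p x) x (l x - ?L) (m x - ?M)"
      by (rule has_slopes_diff[OF slopes])
    moreover have "?M - ?L = (\<Sum>s\<in>S. if s = x then m x - l x else 0)"
      unfolding sum_subtractf[symmetric] by (rule sum.cong) auto
    then have "?M - ?L = m x - l x"
      using S[OF x] fin by (cases "l x = m x") auto
    then have "m x - ?M = l x - ?L" by linarith
    ultimately show ?thesis by auto
  qed
  then obtain k c where kc: "\<And>x. x \<in> {a..b} \<Longrightarrow> g x - p x = k * x + c"
    using affine_if_no_breaks[of a b "\<lambda>x. g x - p x"] by blast
  have "g x = k * x + c + p x" if "x \<in> {a..b}" for x
    using kc[OF that] by simp
  then show ?thesis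
    unfolding p_def by blast
qed

text \<open>
  Both sides are linear in the ramps of the representation; the ramp at \<open>s\<close> contributes
  \<open>\<omega>(s) * (r - \<bar>s\<bar>)\<close> to twice either side.
\<close>

theorem tropical_Jensen:
  assumes "increasing_slopes g" and r: "r > 0"
  shows "trop_counting r (trop_recip g) = 1 / 2 * (g r + g (- r)) - g 0"
proof -
  obtain l m where slopes: "\<And>x. has_slopes g x (l x) (m x)" and le: "\<And>x. l x \<le> m x"
    using assms(1) unfolding increasing_slopes_def by metis
  define w where "w = (\<lambda>s. m s - l s)"
  define S where "S = {s. \<bar>s\<bar> \<le> r \<and> l s \<noteq> m s}"
  have fin: "finite S"
    unfolding S_def by (rule finite_breaks[OF slopes])
  have omega: "trop_omega (trop_recip g) s = - w s" for s
    using trop_omega_eq[OF has_slopes_cmult[OF slopes, of "-1"]]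
    by (simp add: trop_recip_def w_def)
  have count: "trop_pole_count t (trop_recip g) = (\<Sum>s\<in>S. if t \<in> {\<bar>s\<bar>..r} then w s else 0)"
    if t: "t \<in> {0..r}" for t
  proof -
    have "{s. \<bar>s\<bar> \<le> t \<and> trop_pole (trop_recip g) s} = {s \<in> S. t \<in> {\<bar>s\<bar>..r}}"
      using t le by (auto simp: trop_pole_def omega S_def w_def less_le)
    moreover have "\<bar>trop_omega (trop_recip g) s\<bar> = w s" for s
      using le[of s] by (simp add: omega w_def)
    ultimately show ?thesis
      unfolding trop_pole_count_def using fin by (simp add: sum.If_cases Int_def)
  qed
  have "((\<lambda>t. if t \<in> {\<bar>s\<bar>..r} then w s else 0) has_integral w s * (r - \<bar>s\<bar>)) {0..r}"
    if s: "s \<in> S" for s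
  proof -
    have "((\<lambda>t. w s) has_integral w s * (r - \<bar>s\<bar>)) {\<bar>s\<bar>..r}"
      using has_integral_const_real[of "w s" "\<bar>s\<bar>" r] s by (simp add: S_def mult.commute)
    moreover have "{\<bar>s\<bar>..r} \<subseteq> {0..r}" by auto
    ultimately show ?thesis
      by (simp only: has_integral_restrict)
  qed
  then have "((\<lambda>t. \<Sum>s\<in>S. if t \<in> {\<bar>s\<bar>..r} then w s else 0) has_integral
                (\<Sum>s\<in>S. w s * (r - \<bar>s\<bar>))) {0..r}"
    by (intro has_integral_sum fin) auto
  then have "((\<lambda>t. trop_pole_count t (trop_recip g)) has_integral (\<Sum>s\<in>S. w s * (r - \<bar>s\<bar>))) {0..r}"
    by (rule has_integral_eq[rotated]) (simp add: count)
  then have N: "2 * trop_counting r (trop_recip g) = (\<Sum>s\<in>S. w s * (r - \<bar>s\<bar>))"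
    unfolding trop_counting_def by (simp add: integral_unique)
  have "x \<in> S" if "x \<in> {-r..r}" "l x \<noteq> m x" for x
    using that by (auto simp: S_def)
  then obtain k c where g: "\<And>x. x \<in> {-r..r} \<Longrightarrow> g x = k * x + c + (\<Sum>s\<in>S. w s * max 0 (x - s))"
    using ramp_representation[OF slopes fin, of "-r" r] unfolding w_def by blast
  have "g r + g (-r) - 2 * g 0 =
      (\<Sum>s\<in>S. w s * max 0 (r - s)) + (\<Sum>s\<in>S. w s * max 0 (- r - s))
        - 2 * (\<Sum>s\<in>S. w s * max 0 (0 - s))"
    using r by (simp add: g)
  also have "\<dots> = (\<Sum>s\<in>S. w s * (max 0 (r - s) + max 0 (- r - s) - 2 * max 0 (0 - s)))"
    by (simp add: sum.distrib sum_subtractf sum_distrib_left algebra_simps)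
  \<comment> \<open>Since \<open>\<bar>s\<bar> \<le> r\<close>, the ramp at \<open>s\<close> is \<open>r - s\<close> at \<open>r\<close> and \<open>0\<close> at \<open>-r\<close>; at \<open>0\<close> it is \<open>- s\<close> for
    negative \<open>s\<close> and \<open>0\<close> otherwise.\<close>
  also have "\<dots> = (\<Sum>s\<in>S. w s * (r - \<bar>s\<bar>))"
    by (intro sum.cong refl arg_cong2[where f = "(*)"]) (auto simp: S_def)
  finally show ?thesis
    using N by (simp add: field_simps)
qed


section \<open>Curves and hyperplanes with real coefficients\<close>

lemma trop_comp_norm_bound:
  assumes "\<And>i. i \<le> n \<Longrightarrow> \<bar>a i\<bar> \<le> A"
  shows "\<bar>trop_comp n a f x - trop_norm n f x\<bar> \<le> A"
proof -
  have "a i + f i x \<le> A + trop_norm n f x" if "i \<le> n" for i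
  proof -
    have "f i x \<le> trop_norm n f x"
      unfolding trop_norm_def using that by (intro Max_ge) auto
    with assms[OF that] show ?thesis by linarith
  qed
  then have "trop_comp n a f x \<le> A + trop_norm n f x"
    unfolding trop_comp_def trop_linear_def by (subst Max_le_iff) auto
  moreover have "f i x \<le> A + trop_comp n a f x" if "i \<le> n" for i
  proof -
    have "a i + f i x \<le> trop_comp n a f x"
      unfolding trop_comp_def trop_linear_def using that by (intro Max_ge) auto
    with assms[OF that] show ?thesis by linarith
  qed
  then have "trop_norm n f x \<le> A + trop_comp n a f x"
    unfolding trop_norm_def by (subst Max_le_iff) auto
  ultimately show ?thesis by linarith
qed

theorem theorem1p11:
  fixes n :: nat and f :: "nat \<Rightarrow> real \<Rightarrow> real" and a :: "nat \<Rightarrow> real"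
    and H :: "(nat \<Rightarrow> ereal) set set"
  assumes "n \<ge> 1"
    and "trop_reduced_rep n f"
    and "trop_lin_nondegenerate n (trop_curve n f)"
    and "H = trop_hyperplane n (\<lambda>i. ereal (a i))"
  shows "\<exists>C::real. \<forall>r>0.
    \<bar>trop_characteristic n f r - trop_counting r (trop_recip (trop_comp n a f))\<bar> \<le> C"
proof -
  define A where "A = (MAX i\<in>{..n}. \<bar>a i\<bar>)"
  have "\<bar>a i\<bar> \<le> A" if "i \<le> n" for i
    unfolding A_def using that by (intro Max_ge) auto
  then have bound: "\<bar>trop_comp n a f x - trop_norm n f x\<bar> \<le> A" for x
    by (rule trop_comp_norm_bound)
  have "increasing_slopes (trop_comp n a f)"
    unfolding trop_comp_def trop_linear_def
    using assms(2)[unfolded trop_reduced_rep_def]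
    by (intro increasing_slopes_Max increasing_slopes_add_const trop_entire_increasing_slopes) auto
  then have jensen: "trop_counting r (trop_recip (trop_comp n a f)) =
      1 / 2 * (trop_comp n a f r + trop_comp n a f (- r)) - trop_comp n a f 0" if "r > 0" for r
    using that by (rule tropical_Jensen)
  have "\<bar>trop_characteristic n f r - trop_counting r (trop_recip (trop_comp n a f))\<bar> \<le> 2 * A"
    if "r > 0" for r
    unfolding trop_characteristic_def jensen[OF that]
    using bound[of r] bound[of "- r"] bound[of 0] by (simp add: field_simps)
  then show ?thesis by blast
qed

end
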